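(* Let $d\ge2$ and let $H$ be a hypergraph of separated $d$-intervals. Then $\tau(H)\le(d^2-d)\,\nu(H)$.
   Context: Fix $d$ pairwise disjoint copies $L_1,\dots,L_d$ of the real line. A separated $d$-interval is a set of the form $h=h^1\cup\dots\cup h^d$ where each $h^j$ is either empty or a closed interval in $L_j$. A hypergraph of separated $d$-intervals is a finite family $H$ of separated $d$-intervals, regarded as a hypergraph whose vertices are the points of $L_1\cup\dots\cup L_d$. A matching is a set of pairwise disjoint edges and $\nu(H)$ is its maximum size; a cover is a set of points meeting every edge and $\tau(H)$ is the minimum size of a cover. *)

theory Defs
  imports Complex_Main
begin

text \<open>The line L_j (1 \<le> j \<le> d) is modelled as {j} \<times> UNIV inside the type nat \<times> real;
  a point of L_j is a pair (j, x).\<close>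

type_synonym point = "nat \<times> real"

definition sep_d_interval :: "nat \<Rightarrow> point set \<Rightarrow> bool" where
  "sep_d_interval d h \<longleftrightarrow>
     h \<subseteq> {1..d} \<times> UNIV \<and>
     (\<forall>j\<in>{1..d}. {x. (j, x) \<in> h} = {} \<or> (\<exists>a b. a \<le> b \<and> {x. (j, x) \<in> h} = {a..b}))"

definition sep_d_hypergraph :: "nat \<Rightarrow> point set set \<Rightarrow> bool" where
  "sep_d_hypergraph d H \<longleftrightarrow> finite H \<and> (\<forall>h\<in>H. sep_d_interval d h)"

definition is_matching :: "point set set \<Rightarrow> point set set \<Rightarrow> bool" where
  "is_matching H M \<longleftrightarrow> M \<subseteq> H \<and> pairwise disjnt M"

definition matching_number :: "point set set \<Rightarrow> nat" where
  "matching_number H = Max {card M | M. is_matching H M}"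

definition is_cover :: "point set set \<Rightarrow> point set \<Rightarrow> bool" where
  "is_cover H C \<longleftrightarrow> finite C \<and> (\<forall>h\<in>H. C \<inter> h \<noteq> {})"

definition cover_number :: "point set set \<Rightarrow> nat" where
  "cover_number H = Inf {card C | C. is_cover H C}"

end

theory Submission
  imports Defs "HOL-Analysis.Analysis"
begin

text \<open>
  Let \<open>n = (d - 1) \<nu>(H)\<close> and suppose that no \<open>d n\<close> points cover \<open>H\<close>.  A point \<open>x\<close> of the \<open>d\<close>-th
  power of the \<open>n\<close>-simplex cuts each line at \<open>n\<close> places, and some edge avoids all these cuts, so on
  every line it lies inside one of the \<open>n + 1\<close> pieces.  Weighting the edges continuously by how well
  they avoid the cuts, the weight \<open>F x j i\<close> lying in piece \<open>i\<close> of line \<open>j\<close> vanishes when \<open>x (j, i) = 0\<close>.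
  Brouwer's theorem therefore yields cuts for which all pieces of a line carry the same weight.
  This is a fractional matching of size \<open>n + 1\<close> in the \<open>d\<close>-partite hypergraph of pieces, and
  Fueredi's bound \<open>\<nu>* \<le> (d - 1) \<nu>\<close> for \<open>d\<close>-partite hypergraphs turns it into a matching of \<open>H\<close>
  with more than \<open>\<nu>(H)\<close> edges.
\<close>

subsection \<open>Brouwer's theorem and products of simplices\<close>

lemma tendsto_fun_iff:
  fixes f :: "'b \<Rightarrow> 'a \<Rightarrow> 'c::topological_space"
  shows "(f \<longlongrightarrow> l) F \<longleftrightarrow> (\<forall>i. ((\<lambda>x. f x i) \<longlongrightarrow> l i) F)"
  using limitin_componentwise[of "\<lambda>_. euclidean" UNIV f l F]
  by (simp add: euclidean_product_topology)

lemma compact_fun_cube: "compact {x :: 'a \<Rightarrow> real. \<forall>i. x i \<in> {0..1}}"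
proof -
  have "compactin (product_topology (\<lambda>_. euclidean) UNIV) (PiE UNIV (\<lambda>_::'a. {0..1::real}))"
    by (subst compactin_PiE) auto
  moreover have "PiE UNIV (\<lambda>_::'a. {0..1::real}) = {x. \<forall>i. x i \<in> {0..1}}"
    by (auto simp: PiE_UNIV_domain)
  ultimately show ?thesis
    by (simp add: euclidean_product_topology)
qed

text \<open>The dimension needed later depends on \<open>d\<close> and the matching number, so
  points are functions rather than elements of a fixed Euclidean type. Kuhn's combinatorial lemma is
  applied on ever finer grids, and compactness supplies the fixed point as a limit of grid
  cells.\<close>

lemma brouwer_fun_cube:
  fixes f :: "('a::countable \<Rightarrow> real) \<Rightarrow> 'a \<Rightarrow> real" and I :: "'a set"
  assumes "finite I"
    and cont: "\<And>i. i \<in> I \<Longrightarrow> continuous_on {x. \<forall>i. x i \<in> {0..1}} (\<lambda>x. f x i)"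
    and range: "\<And>x i. (\<forall>i. x i \<in> {0..1}) \<Longrightarrow> i \<in> I \<Longrightarrow> f x i \<in> {0..1}"
  obtains x where "\<And>i. x i \<in> {0..1}" and "\<And>i. i \<in> I \<Longrightarrow> f x i = x i"
proof -
  define n where "n = card I"
  define K :: "('a \<Rightarrow> real) set" where "K = {x. \<forall>i. x i \<in> {0..1}}"
  obtain g where g: "bij_betw g {..<n} I"
    using ex_bij_betw_nat_finite[OF \<open>finite I\<close>] by (auto simp: n_def atLeast0LessThan)
  define h where "h = inv_into {..<n} g"
  have gI: "g k \<in> I" and hg: "h (g k) = k" if "k < n" for k
    using that g by (auto simp: h_def bij_betw_def)
  have hn: "h i < n" and gh: "g (h i) = i" if "i \<in> I" for i
    using that g bij_betw_inv_into[OF g] bij_betw_inv_into_right[OF g]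
    by (auto simp: h_def bij_betw_def)
  \<comment> \<open>Grid points of mesh \<open>1 / Suc p\<close>, with the coordinates outside
    \<open>I\<close> frozen at 0.\<close>
  define pt where "pt p q = (\<lambda>i. if i \<in> I then real (q (h i)) / real (Suc p) else 0)"
    for p and q :: "nat \<Rightarrow> nat"
  define near where "near q r \<longleftrightarrow> (\<forall>k<n. q k \<le> r k \<and> r k \<le> q k + 1)" for q r :: "nat \<Rightarrow> nat"
  have ptK: "pt p q \<in> K" if "\<forall>k<n. q k \<le> Suc p" for p q
  proof -
    have "pt p q i \<in> {0..1}" for i
      using that hn[of i] by (auto simp: pt_def divide_simps le_Suc_eq)
    then show ?thesis by (auto simp: K_def)
  qed
  have ex: "\<exists>q. (\<forall>k<n. q k < Suc p) \<and> (\<forall>i\<in>I. \<exists>r s. near q r \<and> near q s \<and>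
      pt p r i \<le> f (pt p r) i \<and> f (pt p s) i \<le> pt p s i)" for p
  proof -
    \<comment> \<open>Label 0 means that \<open>f\<close> does not decrease the coordinate. On the
      top face label 1 is forced, as Kuhn's lemma demands; this is harmless because there
      \<open>f\<close> is at most 1, the value of the coordinate.\<close>
    define label where
      "label q k = (if q k \<noteq> Suc p \<and> pt p q (g k) \<le> f (pt p q) (g k) then 0 else 1 :: nat)" for q k
    have l0: "label x k = 0" if "\<forall>i<n. x i \<le> Suc p" "k < n" "x k = 0" for x k
    proof -
      have "pt p x (g k) = 0" using that by (simp add: pt_def hg gI)
      moreover have "0 \<le> f (pt p x) (g k)"
        using range[of "pt p x" "g k"] ptK[OF that(1)] gI[OF that(2)] by (auto simp: K_def)
      ultimately show ?thesis using that by (simp add: label_def)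
    qed
    obtain q where q: "\<forall>i<n. q i < Suc p"
      and rs: "\<forall>i<n. \<exists>r s. (\<forall>j<n. q j \<le> r j \<and> r j \<le> q j + 1) \<and>
        (\<forall>j<n. q j \<le> s j \<and> s j \<le> q j + 1) \<and> label r i \<noteq> label s i"
      by (rule kuhn_lemma[of "Suc p" n label]) (use l0 in \<open>auto simp: label_def\<close>)
    have "\<exists>r s. near q r \<and> near q s \<and> pt p r i \<le> f (pt p r) i \<and> f (pt p s) i \<le> pt p s i"
      if i: "i \<in> I" for i
    proof -
      obtain r s where "near q r" "near q s" "label r (h i) \<noteq> label s (h i)"
        using rs hn[OF i] unfolding near_def by blast
      then obtain r s where near: "near q r" "near q s"
        and lr: "label r (h i) = 0" and ls: "label s (h i) = 1"
        by (metis label_def)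
      have "\<forall>k<n. s k \<le> Suc p"
      proof (intro allI impI)
        fix k assume "k < n"
        then show "s k \<le> Suc p" using near(2) q by (auto simp: near_def dest!: spec[of _ k])
      qed
      then have "f (pt p s) i \<le> 1" using range[of "pt p s" i] ptK[of s p] i by (auto simp: K_def)
      moreover have "pt p s i = 1" if "s (h i) = Suc p"
        using that i by (simp add: pt_def)
      ultimately have "f (pt p s) i \<le> pt p s i"
        using ls gh[OF i] by (auto simp: label_def split: if_splits)
      moreover have "pt p r i \<le> f (pt p r) i"
        using lr gh[OF i] by (auto simp: label_def split: if_splits)
      ultimately show ?thesis using near by blast
    qed
    then show ?thesis using q by blast
  qed
  obtain Q where Q: "\<And>p k. k < n \<Longrightarrow> Q p k < Suc p"
    and Qrs: "\<And>p i. i \<in> I \<Longrightarrow> \<exists>r s. near (Q p) r \<and> near (Q p) s \<and>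
      pt p r i \<le> f (pt p r) i \<and> f (pt p s) i \<le> pt p s i"
    using ex by metis
  \<comment> \<open>The index type is countable, so the function space is first countable and
    compactness gives convergent subsequences.\<close>
  have "seq_compact K"
    unfolding K_def by (intro compact_imp_seq_compact compact_fun_cube)
  moreover have "\<forall>p. pt p (Q p) \<in> K" using Q by (intro allI ptK) (auto intro: less_imp_le)
  ultimately obtain x \<phi> where x: "x \<in> K" and \<phi>: "strict_mono \<phi>"
    and lim: "((\<lambda>p. pt p (Q p)) \<circ> \<phi>) \<longlonglongrightarrow> x"
    unfolding seq_compact_def by metis
  \<comment> \<open>Corners of the same Kuhn cell differ from its base point by at most one mesh
    width in each coordinate, so every choice of corners has the same limit \<open>x\<close>. The
    two corners with opposite labels then give both inequalities between \<open>f x i\<close> and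
    \<open>x i\<close>.\<close>
  have lim_near: "(\<lambda>m. pt (\<phi> m) (R m)) \<longlonglongrightarrow> x" and in_K: "\<And>m. pt (\<phi> m) (R m) \<in> K"
    if R: "\<And>m. near (Q (\<phi> m)) (R m)" for R
  proof -
    show "pt (\<phi> m) (R m) \<in> K" for m
      using R[of m] Q[of _ "\<phi> m"] by (intro ptK) (fastforce simp: near_def)
    have "(\<lambda>m. pt (\<phi> m) (R m) i) \<longlonglongrightarrow> x i" for i
    proof -
      have "(\<lambda>m. pt (\<phi> m) (Q (\<phi> m)) i) \<longlonglongrightarrow> x i"
        using lim by (simp add: tendsto_fun_iff o_def)
      moreover have "(\<lambda>m. pt (\<phi> m) (R m) i - pt (\<phi> m) (Q (\<phi> m)) i) \<longlonglongrightarrow> 0"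
      proof (rule Lim_null_comparison)
        have "norm (pt (\<phi> m) (R m) i - pt (\<phi> m) (Q (\<phi> m)) i) \<le> inverse (real (Suc m))" for m
        proof (cases "i \<in> I")
          case True
          have "real (R m (h i)) \<le> real (Q (\<phi> m) (h i)) + 1" "Q (\<phi> m) (h i) \<le> R m (h i)"
            using R[of m] hn[OF True] by (auto simp: near_def)
          then have "\<bar>real (R m (h i)) - real (Q (\<phi> m) (h i))\<bar> \<le> 1" by simp
          then have "\<bar>(real (R m (h i)) - real (Q (\<phi> m) (h i))) / real (Suc (\<phi> m))\<bar> \<le> 1 / real (Suc (\<phi> m))"
            unfolding abs_divide by (simp add: divide_right_mono)
          also have "\<dots> \<le> inverse (real (Suc m))"
            using seq_suble[OF \<phi>, of m] by (simp add: divide_simps)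
          finally show ?thesis using True by (simp add: pt_def diff_divide_distrib)
        qed (simp add: pt_def)
        then show "\<forall>\<^sub>F m in sequentially. norm (pt (\<phi> m) (R m) i - pt (\<phi> m) (Q (\<phi> m)) i)
            \<le> inverse (real (Suc m))" by simp
        show "(\<lambda>m. inverse (real (Suc m))) \<longlonglongrightarrow> 0" by (rule LIMSEQ_inverse_real_of_nat)
      qed
      ultimately show ?thesis by (rule Lim_transform)
    qed
    then show "(\<lambda>m. pt (\<phi> m) (R m)) \<longlonglongrightarrow> x" by (simp add: tendsto_fun_iff)
  qed
  have "f x i = x i" if i: "i \<in> I" for i
  proof -
    obtain r s where near: "\<And>p. near (Q p) (r p)" "\<And>p. near (Q p) (s p)"
      and r: "\<And>p. pt p (r p) i \<le> f (pt p (r p)) i" and s: "\<And>p. f (pt p (s p)) i \<le> pt p (s p) i"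
      using Qrs[OF i] by metis
    have lims: "(\<lambda>m. f (pt (\<phi> m) (R (\<phi> m))) i) \<longlonglongrightarrow> f x i" "(\<lambda>m. pt (\<phi> m) (R (\<phi> m)) i) \<longlonglongrightarrow> x i"
      if "\<And>p. near (Q p) (R p)" for R
    proof -
      show "(\<lambda>m. f (pt (\<phi> m) (R (\<phi> m))) i) \<longlonglongrightarrow> f x i"
        using in_K[of "\<lambda>m. R (\<phi> m)"] that
        by (intro continuous_on_tendsto_compose[OF cont[OF i, folded K_def] lim_near[of "\<lambda>m. R (\<phi> m)"] x])
           auto
      show "(\<lambda>m. pt (\<phi> m) (R (\<phi> m)) i) \<longlonglongrightarrow> x i"
        using lim_near[of "\<lambda>m. R (\<phi> m)"] that by (simp add: tendsto_fun_iff)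
    qed
    have "x i \<le> f x i" by (rule LIMSEQ_le[OF lims(2)[OF near(1)] lims(1)[OF near(1)]]) (use r in auto)
    moreover have "f x i \<le> x i"
      by (rule LIMSEQ_le[OF lims(1)[OF near(2)] lims(2)[OF near(2)]]) (use s in auto)
    ultimately show ?thesis by simp
  qed
  then show thesis using that[of x] x by (auto simp: K_def)
qed

text \<open>The balance point is a fixed point of the map \<open>G\<close> that moves \<open>x\<close> towards the coordinates on
  which \<open>F\<close> is below average; \<open>r\<close> retracts the cube onto the product of simplices.\<close>

lemma face_preserving_balanced:
  fixes F :: "('j::countable \<times> 'i::countable \<Rightarrow> real) \<Rightarrow> 'j \<Rightarrow> 'i \<Rightarrow> real"
  assumes "finite J" "finite I" "I \<noteq> {}"
    and cont: "\<And>j i. j \<in> J \<Longrightarrow> i \<in> I \<Longrightarrow> continuous_on UNIV (\<lambda>x. F x j i)"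
    and nonneg: "\<And>x j i. F x j i \<ge> 0"
    and face: "\<And>x j i. \<lbrakk>\<And>p. x p \<ge> 0; \<And>j. j \<in> J \<Longrightarrow> (\<Sum>i\<in>I. x (j, i)) = 1;
      j \<in> J; i \<in> I; x (j, i) = 0\<rbrakk> \<Longrightarrow> F x j i = 0"
  obtains x where "\<And>p. x p \<ge> 0" "\<And>j. j \<in> J \<Longrightarrow> (\<Sum>i\<in>I. x (j, i)) = 1"
    "\<And>j i. j \<in> J \<Longrightarrow> i \<in> I \<Longrightarrow> real (card I) * F x j i = (\<Sum>i'\<in>I. F x j i')"
proof -
  define c where "c = real (card I)"
  have c: "c > 0" using assms(2,3) by (simp add: c_def card_gt_0_iff)
  define s where "s y j = (\<Sum>i\<in>I. y (j, i))" for y :: "'j \<times> 'i \<Rightarrow> real" and j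
  \<comment> \<open>Missing mass is spread evenly over the part and excess mass is scaled away; a
    part with sum 1 is left alone.\<close>
  define r where "r y = (\<lambda>p. (y p + max 0 (1 - s y (fst p)) / c) / max 1 (s y (fst p)))" for y
  define u where "u x j i = max 0 ((\<Sum>i'\<in>I. F x j i') - c * F x j i)" for x j i
  define G where "G y p = (r y p + u (r y) (fst p) (snd p)) / (1 + (\<Sum>i\<in>I. u (r y) (fst p) i))" for y p
  have u0: "u x j i \<ge> 0" for x j i by (simp add: u_def)
  have r0: "r y p \<ge> 0" if "\<forall>p. y p \<in> {0..1}" for y p
  proof -
    have "y p \<ge> 0" using that by (metis atLeastAtMost_iff)
    then show ?thesis using c by (simp add: r_def)
  qed
  have r1: "(\<Sum>i\<in>I. r y (j, i)) = 1" for y j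
  proof -
    have "(\<Sum>i\<in>I. r y (j, i)) = (s y j + c * (max 0 (1 - s y j) / c)) / max 1 (s y j)"
      unfolding r_def by (simp add: sum_divide_distrib[symmetric] sum.distrib s_def c_def)
    also have "\<dots> = (s y j + max 0 (1 - s y j)) / max 1 (s y j)" using c by simp
    also have "\<dots> = 1" by (cases "s y j \<le> 1") (auto simp: max_def)
    finally show ?thesis .
  qed
  have r_le: "r y (j, i) \<le> 1" if "\<forall>p. y p \<in> {0..1}" "i \<in> I" for y j i
  proof -
    have "r y (j, i) \<le> (\<Sum>i\<in>I. r y (j, i))"
      by (rule member_le_sum) (use that r0 assms(2) in auto)
    then show ?thesis using r1 by simp
  qed
  have coord: "continuous_on S (\<lambda>y. y p)" for S :: "('j \<times> 'i \<Rightarrow> real) set" and p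
    using continuous_on_product_coordinates[of p] by (rule continuous_on_subset) auto
  have cs: "continuous_on S (\<lambda>y. s y j)" for S j
    unfolding s_def by (intro continuous_intros coord)
  have cr: "continuous_on S (\<lambda>y. r y p)" for S p
    unfolding r_def by (intro continuous_intros coord cs) (use c in auto)
  have cF: "continuous_on S (\<lambda>y. F (r y) j i)" if "j \<in> J" "i \<in> I" for S j i
    by (rule continuous_on_compose2[OF cont[OF that]])
       (auto intro!: continuous_on_coordinatewise_then_product cr)
  have cu: "continuous_on S (\<lambda>y. u (r y) j i)" if "j \<in> J" "i \<in> I" for S j i
    unfolding u_def by (intro continuous_intros cF that)
  have pos: "1 + (\<Sum>i\<in>I. u x j i) > 0" for x j
    using sum_nonneg[of I "u x j"] u0 by (smt (verit))
  have pos': "1 + (\<Sum>i\<in>I. u x j i) \<noteq> 0" for x j using pos[of x j] by linarith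
  obtain x where x01: "\<And>p. x p \<in> {0..1}" and fix_x: "\<And>p. p \<in> J \<times> I \<Longrightarrow> G x p = x p"
  proof (rule brouwer_fun_cube[of "J \<times> I" G])
    show "finite (J \<times> I)" using assms by simp
    show "continuous_on {x. \<forall>i. x i \<in> {0..1}} (\<lambda>x. G x p)" if "p \<in> J \<times> I" for p
      unfolding G_def by (intro continuous_intros cr cu) (use that pos' in auto)
    show "G y p \<in> {0..1}" if y: "\<forall>p. y p \<in> {0..1}" and p: "p \<in> J \<times> I" for y p
    proof -
      obtain j i where ji: "p = (j, i)" "i \<in> I" using p by auto
      have "u (r y) j i \<le> (\<Sum>i\<in>I. u (r y) j i)"
        by (rule member_le_sum) (use ji u0 assms(2) in auto)
      then show ?thesis
        using r_le[OF y ji(2), of j] r0[OF y, of p] u0[of "r y" j i] pos[of "r y" j] ji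
        by (simp add: G_def)
    qed
  qed blast
  have G_sum: "(\<Sum>i\<in>I. G y (j, i)) = 1" for y j
    using pos'[of "r y" j]
    by (simp add: G_def sum_divide_distrib[symmetric] sum.distrib r1)
  have x1: "s x j = 1" if "j \<in> J" for j
    using G_sum[of x j] fix_x that by (simp add: s_def cong: sum.cong)
  have rx: "r x (j, i) = x (j, i)" if "j \<in> J" for j i
    using x1[OF that] by (simp add: r_def)
  let ?z = "r x"
  have z0: "\<And>p. ?z p \<ge> 0" using r0 x01 by simp
  have "c * F ?z j i = (\<Sum>i'\<in>I. F ?z j i')" if j: "j \<in> J" and i: "i \<in> I" for j i
  proof -
    define T where "T = (\<Sum>i'\<in>I. F ?z j i')"
    define S where "S = (\<Sum>i\<in>I. u ?z j i)"
    have T0: "T \<ge> 0" by (simp add: T_def sum_nonneg nonneg)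
    \<comment> \<open>Clearing the denominator in the fixed-point equation: if \<open>S\<close> is
      nonzero, then \<open>u\<close> is nonzero exactly at the nonzero coordinates.\<close>
    have fp: "u ?z j k = ?z (j, k) * S" if "k \<in> I" for k
    proof -
      have "(?z (j, k) + u ?z j k) / (1 + S) = ?z (j, k)"
        using fix_x[of "(j, k)"] that j rx[OF j, of k] by (simp add: G_def S_def)
      then show ?thesis using pos'[of ?z j] by (simp add: S_def field_simps)
    qed
    have tot: "(\<Sum>k\<in>I. c * F ?z j k) = (\<Sum>k\<in>I. T)"
      by (simp add: sum_distrib_left[symmetric] T_def c_def)
    have "S = 0"
    proof (rule ccontr)
      assume "S \<noteq> 0"
      have "T \<noteq> 0"
      proof
        assume "T = 0"
        then have "F ?z j k = 0" if "k \<in> I" for k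
          using that assms(2) nonneg by (simp add: T_def sum_nonneg_eq_0_iff)
        then have "S = 0" by (simp add: S_def u_def)
        then show False using \<open>S \<noteq> 0\<close> by simp
      qed
      \<comment> \<open>Every value would lie strictly below the average: at a zero coordinate
        \<open>face\<close> gives the value 0, and at any other coordinate \<open>u\<close> is
        positive. This contradicts \<open>tot\<close>.\<close>
      have "c * F ?z j k < T" if k: "k \<in> I" for k
      proof (cases "?z (j, k) = 0")
        case True
        then have "F ?z j k = 0" using face[of ?z j k] z0 r1 j k by simp
        then show ?thesis using \<open>T \<noteq> 0\<close> T0 by simp
      next
        case False
        then have "u ?z j k \<noteq> 0" using fp[OF k] \<open>S \<noteq> 0\<close> by simp
        then show ?thesis by (simp add: u_def T_def max_def split: if_splits)
      qed
      then have "(\<Sum>k\<in>I. c * F ?z j k) < (\<Sum>k\<in>I. T)"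
        by (intro sum_strict_mono) (use assms in auto)
      then show False using tot by simp
    qed
    then have "u ?z j k = 0" if "k \<in> I" for k using fp[OF that] by simp
    \<comment> \<open>Now no value is below the average, so none can be above it either.\<close>
    then have le: "T \<le> c * F ?z j k" if "k \<in> I" for k
      using that by (force simp: u_def T_def max_def split: if_splits)
    have "c * F ?z j i = T"
    proof (rule ccontr)
      assume "c * F ?z j i \<noteq> T"
      then have "(\<Sum>k\<in>I. T) < (\<Sum>k\<in>I. c * F ?z j k)"
        by (intro sum_strict_mono_ex1) (use le i assms(2) in \<open>auto intro!: bexI[of _ i] simp: less_le\<close>)
      then show False using tot by simp
    qed
    then show ?thesis by (simp add: T_def)
  qed
  then show thesis using that[of ?z] z0 r1 by (simp add: c_def)
qed

subsection \<open>Fractional matchings in multipartite hypergraphs\<close>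

lemma underdetermined_system_nontrivial_solution:
  fixes a :: "'t \<Rightarrow> 'e \<Rightarrow> 'a::field"
  assumes "finite T" "finite E" "card T < card E"
  shows "\<exists>z. (\<exists>e\<in>E. z e \<noteq> 0) \<and> (\<forall>t\<in>T. (\<Sum>e\<in>E. a t e * z e) = 0)"
  using assms
proof (induction T arbitrary: E a rule: finite_induct)
  case empty
  then have "E \<noteq> {}" by auto
  then show ?case by (intro exI[of _ "\<lambda>_. 1"]) auto
next
  case (insert t T)
  show ?case
  proof (cases "\<forall>e\<in>E. a t e = 0")
    case True
    have "card T < card E" using insert by simp
    from insert.IH[OF insert.prems(1) this, of a] show ?thesis using True by auto
  next
    case False
    then obtain e0 where e0: "e0 \<in> E" "a t e0 \<noteq> 0" by blast
    define E' where "E' = E - {e0}"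
    have "card T < card E'" "finite E'" using insert e0 by (auto simp: E'_def)
    \<comment> \<open>Gaussian elimination: equation \<open>t\<close> is solved for the unknown
      \<open>e0\<close> and substituted into the others. The extension \<open>z'\<close> then gives
      \<open>e0\<close> the value that satisfies equation \<open>t\<close>.\<close>
    from insert.IH[OF this(2,1), of "\<lambda>s e. a s e - a s e0 * a t e / a t e0"]
    obtain z where z: "\<exists>e\<in>E'. z e \<noteq> 0"
      and eq: "\<And>s. s \<in> T \<Longrightarrow> (\<Sum>e\<in>E'. (a s e - a s e0 * a t e / a t e0) * z e) = 0" by blast
    define z' where "z' = z(e0 := - (\<Sum>e\<in>E'. a t e * z e) / a t e0)"
    have split: "(\<Sum>e\<in>E. a s e * z' e)
      = (\<Sum>e\<in>E'. a s e * z e) - a s e0 * (\<Sum>e\<in>E'. a t e * z e) / a t e0" for s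
    proof -
      have "(\<Sum>e\<in>E. a s e * z' e) = a s e0 * z' e0 + (\<Sum>e\<in>E'. a s e * z' e)"
        unfolding E'_def using e0 insert by (subst sum.remove[of _ e0]) auto
      also have "(\<Sum>e\<in>E'. a s e * z' e) = (\<Sum>e\<in>E'. a s e * z e)"
        by (intro sum.cong) (auto simp: z'_def E'_def)
      finally show ?thesis by (simp add: z'_def)
    qed
    have "(\<Sum>e\<in>E. a s e * z' e) = 0" if "s \<in> T" for s
      using eq[OF that] unfolding split
      by (simp add: left_diff_distrib sum_subtractf sum_distrib_left sum_divide_distrib mult.assoc)
    moreover have "(\<Sum>e\<in>E. a t e * z' e) = 0" unfolding split using e0 by simp
    moreover have "\<exists>e\<in>E. z' e \<noteq> 0" using z by (auto simp: z'_def E'_def)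
    ultimately show ?thesis by blast
  qed
qed

text \<open>The ratio test of the simplex method: \<open>t\<close> is the least quotient of \<alpha>
  by -\<beta> over the constraints with negative \<beta>. It is positive because \<beta> vanishes on
  constraints that are already tight. Thus tight constraints stay tight and a new one becomes
  tight.\<close>

lemma maximal_step_to_boundary:
  fixes \<alpha> \<beta> :: "'c \<Rightarrow> real"
  assumes "finite C" and \<alpha>: "\<And>c. c \<in> C \<Longrightarrow> \<alpha> c \<ge> 0"
    and \<beta>: "\<And>c. c \<in> C \<Longrightarrow> \<alpha> c = 0 \<Longrightarrow> \<beta> c = 0" and neg: "\<exists>c\<in>C. \<beta> c < 0"
  obtains t where "t > 0" "\<And>c. c \<in> C \<Longrightarrow> \<alpha> c + t * \<beta> c \<ge> 0"
    "\<exists>c\<in>C. \<alpha> c \<noteq> 0 \<and> \<alpha> c + t * \<beta> c = 0"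
proof -
  define N where "N = {c\<in>C. \<beta> c < 0}"
  define q where "q c = \<alpha> c / - \<beta> c" for c
  have N: "finite N" "N \<noteq> {}" using assms by (auto simp: N_def)
  obtain c0 where c0: "c0 \<in> N" "\<And>c. c \<in> N \<Longrightarrow> q c0 \<le> q c"
    using ex_is_arg_min_if_finite[OF N, of q] unfolding is_arg_min_linorder by blast
  have pos: "\<alpha> c > 0" if "c \<in> N" for c
    using that \<alpha>[of c] \<beta>[of c] by (auto simp: N_def less_le)
  show thesis
  proof (rule that[of "q c0"])
    show "q c0 > 0" using pos[OF c0(1)] c0(1) by (auto simp: q_def N_def divide_pos_neg)
    then show "\<alpha> c + q c0 * \<beta> c \<ge> 0" if "c \<in> C" for c
    proof (cases "c \<in> N")
      case True
      then have "q c0 * (- \<beta> c) \<le> q c * (- \<beta> c)"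
        by (intro mult_right_mono c0(2)) (auto simp: N_def)
      also have "\<dots> = \<alpha> c" using True by (auto simp: q_def N_def)
      finally show ?thesis by simp
    next
      case False
      then have "\<beta> c \<ge> 0" using that by (auto simp: N_def)
      then show ?thesis using \<alpha>[OF that] \<open>q c0 > 0\<close> by simp
    qed
    show "\<exists>c\<in>C. \<alpha> c \<noteq> 0 \<and> \<alpha> c + q c0 * \<beta> c = 0"
      using c0(1) pos[OF c0(1)] by (intro bexI[of _ c0]) (auto simp: q_def N_def)
  qed
qed

text \<open>Edges of a multipartite hypergraph are indexed by \<open>E\<close>; edge \<open>e\<close> has the vertex \<open>v e j\<close>
  in part \<open>j\<close>.\<close>

definition wdeg :: "'e set \<Rightarrow> ('e \<Rightarrow> 'j \<Rightarrow> 'k) \<Rightarrow> ('e \<Rightarrow> real) \<Rightarrow> 'j \<Rightarrow> 'k \<Rightarrow> real" where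
  "wdeg E v w j i = (\<Sum>e\<in>E. if v e j = i then w e else 0)"

lemma wdeg_add_scaled: "wdeg E v (\<lambda>e. w e + t * z e) j i = wdeg E v w j i + t * wdeg E v z j i"
  unfolding wdeg_def sum_distrib_left sum.distrib[symmetric] by (intro sum.cong) auto

lemma wdeg_scaled: "wdeg E v (\<lambda>e. t * z e) j i = t * wdeg E v z j i"
  unfolding wdeg_def sum_distrib_left by (intro sum.cong) auto

lemma sum_wdeg:
  assumes "finite E" "finite A" "(\<lambda>e. v e j) ` E \<subseteq> A"
  shows "(\<Sum>i\<in>A. wdeg E v w j i) = sum w E"
proof -
  have "(\<Sum>i\<in>A. wdeg E v w j i) = (\<Sum>e\<in>E. \<Sum>i\<in>A. if v e j = i then w e else 0)"
    unfolding wdeg_def by (rule sum.swap)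
  also have "\<dots> = sum w E"
    using assms by (intro sum.cong) (auto simp: sum.delta)
  finally show ?thesis .
qed

text \<open>Among the fractional matchings of total at least \<open>sum w0 E\<close>, one with the
  fewest non-tight constraints is chosen. If a nonzero \<open>z\<close> kept all its tight
  constraints tight, then moving along \<open>z\<close> or \<open>- z\<close>, whichever does not
  lower the total, would make another constraint tight.\<close>

lemma basic_fractional_matching:
  fixes v :: "'e \<Rightarrow> 'j \<Rightarrow> 'k" and w0 :: "'e \<Rightarrow> real"
  assumes "finite E" "finite J" "J \<noteq> {}"
    and w0: "\<And>e. e \<in> E \<Longrightarrow> w0 e \<ge> 0" "\<And>j i. j \<in> J \<Longrightarrow> wdeg E v w0 j i \<le> 1"
  obtains w where "\<And>e. e \<in> E \<Longrightarrow> w e \<ge> 0" "\<And>j i. j \<in> J \<Longrightarrow> wdeg E v w j i \<le> 1"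
    "sum w0 E \<le> sum w E"
    "\<forall>z. (\<forall>e\<in>E. w e = 0 \<longrightarrow> z e = 0) \<and>
       (\<forall>j\<in>J. \<forall>i. wdeg E v w j i = 1 \<longrightarrow> wdeg E v z j i = 0) \<longrightarrow> (\<forall>e\<in>E. z e = 0)"
proof -
  \<comment> \<open>Constraints are indexed by \<open>C\<close>: \<open>Inl e\<close> for
    nonnegativity at an edge, \<open>Inr (j, i)\<close> for the degree bound at a vertex. Only
    vertices on some edge are listed, which keeps \<open>C\<close> finite; all others have degree
    0.\<close>
  define V where "V = (SIGMA j:J. (\<lambda>e. v e j) ` E)"
  define C where "C = E <+> V"
  define slack where "slack w = case_sum w (\<lambda>(j, i). 1 - wdeg E v w j i)" for w
  define feas where "feas w \<longleftrightarrow> (\<forall>c\<in>C. slack w c \<ge> 0) \<and> sum w0 E \<le> sum w E" for w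
  have "finite V" "finite C" using assms by (auto simp: V_def C_def)
  have wdeg0: "wdeg E v w j i = 0" if "j \<in> J" "(j, i) \<notin> V" for w j i
    using that by (auto simp: V_def wdeg_def intro!: sum.neutral)
  have feas_iff: "feas w \<longleftrightarrow> (\<forall>e\<in>E. w e \<ge> 0) \<and> (\<forall>j\<in>J. \<forall>i. wdeg E v w j i \<le> 1) \<and> sum w0 E \<le> sum w E"
    for w
  proof -
    have "(\<forall>c\<in>C. slack w c \<ge> 0) \<longleftrightarrow> (\<forall>e\<in>E. w e \<ge> 0) \<and> (\<forall>(j, i)\<in>V. wdeg E v w j i \<le> 1)"
      by (auto simp: C_def slack_def Plus_def ball_Un)
    also have "(\<forall>(j, i)\<in>V. wdeg E v w j i \<le> 1) \<longleftrightarrow> (\<forall>j\<in>J. \<forall>i. wdeg E v w j i \<le> 1)"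
    proof safe
      fix j i assume "\<forall>(j, i)\<in>V. wdeg E v w j i \<le> 1" "j \<in> J"
      then show "wdeg E v w j i \<le> 1" using wdeg0[of j i w] by (cases "(j, i) \<in> V") auto
    qed (auto simp: V_def)
    finally show ?thesis by (simp add: feas_def)
  qed
  have "feas w0" using w0 by (simp add: feas_iff)
  then obtain w where w: "feas w"
    and least: "\<And>w'. feas w' \<Longrightarrow> card {c\<in>C. slack w c \<noteq> 0} \<le> card {c\<in>C. slack w' c \<noteq> 0}"
    using ex_has_least_nat[of feas w0 "\<lambda>w. card {c\<in>C. slack w c \<noteq> 0}"] by blast
  have no_move: False
    if z: "\<And>e. e \<in> E \<Longrightarrow> w e = 0 \<Longrightarrow> z e = 0"
      "\<And>j i. j \<in> J \<Longrightarrow> wdeg E v w j i = 1 \<Longrightarrow> wdeg E v z j i = 0"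
      and nz: "\<exists>e\<in>E. z e \<noteq> 0" and sum_z: "sum z E \<ge> 0" for z
  proof -
    define \<beta> where "\<beta> = case_sum z (\<lambda>(j, i). - wdeg E v z j i)"
    have step: "slack (\<lambda>e. w e + t * z e) c = slack w c + t * \<beta> c" for t c
      by (cases c) (auto simp: slack_def \<beta>_def wdeg_add_scaled)
    \<comment> \<open>The motion cannot continue forever: either some weight decreases, or all of
      \<open>z\<close> is nonnegative and the degree grows at a vertex of an edge with positive
      \<open>z\<close>.\<close>
    have "\<exists>c\<in>C. \<beta> c < 0"
    proof (cases "\<exists>e\<in>E. z e < 0")
      case True
      then show ?thesis by (force simp: C_def \<beta>_def)
    next
      case False
      obtain e j where e: "e \<in> E" "z e > 0" and j: "j \<in> J"
        using nz False \<open>J \<noteq> {}\<close> by (metis ex_in_conv linorder_neqE_linordered_idom)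
      have "wdeg E v z j (v e j) > 0"
        unfolding wdeg_def using e False by (intro sum_pos2[OF \<open>finite E\<close> e(1)]) auto
      then show ?thesis
        using e j by (intro bexI[of _ "Inr (j, v e j)"]) (auto simp: \<beta>_def C_def V_def)
    qed
    moreover have "\<beta> c = 0" if "c \<in> C" "slack w c = 0" for c
      using that z by (auto simp: C_def \<beta>_def slack_def V_def)
    ultimately obtain t where t: "t > 0" "\<And>c. c \<in> C \<Longrightarrow> slack w c + t * \<beta> c \<ge> 0"
      and ex: "\<exists>c\<in>C. slack w c \<noteq> 0 \<and> slack w c + t * \<beta> c = 0"
      using maximal_step_to_boundary[OF \<open>finite C\<close>, of "slack w" \<beta>] w unfolding feas_def by metis
    define w' where "w' = (\<lambda>e. w e + t * z e)"
    have "sum w' E = sum w E + t * sum z E"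
      by (simp add: w'_def sum.distrib sum_distrib_left)
    moreover have "t * sum z E \<ge> 0" using t sum_z by simp
    ultimately have "feas w'" using w t(2) by (simp add: feas_def step w'_def del: zero_le_mult_iff)
    moreover have "{c\<in>C. slack w' c \<noteq> 0} \<subset> {c\<in>C. slack w c \<noteq> 0}"
      using ex \<open>\<And>c. c \<in> C \<Longrightarrow> slack w c = 0 \<Longrightarrow> \<beta> c = 0\<close> by (auto simp: step w'_def)
    then have "card {c\<in>C. slack w' c \<noteq> 0} < card {c\<in>C. slack w c \<noteq> 0}"
      using \<open>finite C\<close> by (intro psubset_card_mono) auto
    ultimately show False using least[of w'] by simp
  qed
  show thesis
  proof (rule that[of w])
    have neg: "wdeg E v (\<lambda>e. - z e) j i = - wdeg E v z j i" for z j i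
      using wdeg_scaled[of E v "-1" z j i] by simp
    have "\<forall>e\<in>E. z e = 0"
      if z: "\<forall>e\<in>E. w e = 0 \<longrightarrow> z e = 0" "\<forall>j\<in>J. \<forall>i. wdeg E v w j i = 1 \<longrightarrow> wdeg E v z j i = 0" for z
    proof (rule ccontr)
      assume "\<not> (\<forall>e\<in>E. z e = 0)"
      then show False
        using no_move[of z] no_move[of "\<lambda>e. - z e"] z
        by (cases "sum z E \<ge> 0") (auto simp: neg sum_negf)
    qed
    then show "\<forall>z. (\<forall>e\<in>E. w e = 0 \<longrightarrow> z e = 0) \<and>
       (\<forall>j\<in>J. \<forall>i. wdeg E v w j i = 1 \<longrightarrow> wdeg E v z j i = 0) \<longrightarrow> (\<forall>e\<in>E. z e = 0)" by blast
  qed (use w in \<open>auto simp: feas_iff\<close>)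
qed

text \<open>If every edge of a basic solution weighed less than \<open>1 / (d - 1)\<close>, each tight vertex would
  lie on at least \<open>d\<close> edges; counting incidences, the number of tight constraints is at most
  the number of edges, with equality only if all vertices are tight.  But then the constraints are
  dependent, since each part gives the same total.\<close>

lemma basic_fractional_matching_heavy_edge:
  fixes v :: "'e \<Rightarrow> 'j \<Rightarrow> 'k" and w :: "'e \<Rightarrow> real"
  assumes "finite E" "finite J" "card J \<ge> 2"
    and basic: "\<forall>z. (\<forall>e\<in>E. w e = 0 \<longrightarrow> z e = 0) \<and>
       (\<forall>j\<in>J. \<forall>i. wdeg E v w j i = 1 \<longrightarrow> wdeg E v z j i = 0) \<longrightarrow> (\<forall>e\<in>E. z e = 0)"
    and ne: "\<exists>e\<in>E. w e \<noteq> 0"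
  obtains e where "e \<in> E" "real (card J - 1) * w e \<ge> 1"
proof (rule ccontr)
  assume "\<not> thesis"
  then have light: "real (card J - 1) * w e < 1" if "e \<in> E" for e
    using that \<open>\<And>e. \<lbrakk>e \<in> E; 1 \<le> real (card J - 1) * w e\<rbrakk> \<Longrightarrow> thesis\<close> by fastforce
  define d where "d = card J"
  define S where "S = {e\<in>E. w e \<noteq> 0}"
  define V where "V = (SIGMA j:J. (\<lambda>e. v e j) ` S)"
  define T where "T = {(j, i)\<in>V. wdeg E v w j i = 1}"
  define inc where "inc j i = {e\<in>S. v e j = i}" for j i
  have TV: "T \<subseteq> V" by (auto simp: T_def)
  have finSV: "finite S" "finite V" using assms(1,2) by (auto simp: S_def V_def)
  then have fin: "finite S" "finite V" "finite T" "S \<noteq> {}" "J \<noteq> {}"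
    using ne assms(3) finite_subset[OF TV] by (auto simp: S_def)
  have wdeg_S: "wdeg E v z j i = wdeg S v z j i" if "\<And>e. e \<in> E \<Longrightarrow> w e = 0 \<Longrightarrow> z e = 0" for z j i
    unfolding wdeg_def using that assms(1) by (intro sum.mono_neutral_right) (auto simp: S_def)
  have tight_in: "(j, i) \<in> T" if "j \<in> J" "wdeg E v w j i = 1" for j i
  proof -
    have "\<exists>e\<in>S. v e j = i"
    proof (rule ccontr)
      assume "\<not> ?thesis"
      then have "wdeg S v w j i = 0" by (auto simp: wdeg_def intro!: sum.neutral)
      then show False using that wdeg_S[of w] by simp
    qed
    then show ?thesis using that by (auto simp: T_def V_def)
  qed
  \<comment> \<open>If the constraints in \<open>T'\<close> force all tight ones, they must
    determine the weights on \<open>S\<close>; with fewer equations than unknowns a nonzero solution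
    would contradict \<open>basic\<close>.\<close>
  have few: "card S \<le> card T'" if T': "T' \<subseteq> T"
    and implied: "\<And>z j i. \<lbrakk>\<And>j i. (j, i) \<in> T' \<Longrightarrow> wdeg S v z j i = 0; (j, i) \<in> T\<rbrakk> \<Longrightarrow> wdeg S v z j i = 0"
    for T'
  proof (rule ccontr)
    assume "\<not> card S \<le> card T'"
    then have lt: "card T' < card S" by simp
    have "finite T'" using T' fin finite_subset by blast
    from underdetermined_system_nontrivial_solution[OF this fin(1) lt,
        of "\<lambda>t e. if v e (fst t) = snd t then 1 else 0 :: real"]
    obtain z :: "'e \<Rightarrow> real" where nz: "\<exists>e\<in>S. z e \<noteq> 0"
      and z: "\<forall>t\<in>T'. (\<Sum>e\<in>S. (if v e (fst t) = snd t then 1 else 0) * z e) = 0"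
      by blast
    have z': "wdeg S v z j i = 0" if "(j, i) \<in> T'" for j i
    proof -
      have "wdeg S v z j i = (\<Sum>e\<in>S. (if v e (fst (j, i)) = snd (j, i) then 1 else 0) * z e)"
        unfolding wdeg_def by (intro sum.cong) auto
      then show ?thesis using bspec[OF z that] by simp
    qed
    \<comment> \<open>Extension by zero turns a direction on the support into one on all of
      \<open>E\<close>.\<close>
    define y where "y e = (if e \<in> S then z e else 0)" for e
    have y: "y e = 0" if "e \<in> E" "w e = 0" for e using that by (simp add: y_def S_def)
    have "wdeg S v y j i = wdeg S v z j i" for j i
      unfolding wdeg_def by (intro sum.cong) (auto simp: y_def)
    then have "\<forall>j\<in>J. \<forall>i. wdeg E v w j i = 1 \<longrightarrow> wdeg E v y j i = 0"
      using implied[OF z'] tight_in y by (simp add: wdeg_S)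
    then have "\<forall>e\<in>E. y e = 0" using basic y by blast
    then show False using nz by (auto simp: y_def S_def)
  qed
  have tight_deg: "card (inc j i) \<ge> d" if "(j, i) \<in> T" for j i
  proof (rule ccontr)
    assume "\<not> card (inc j i) \<ge> d"
    then have less: "card (inc j i) \<le> d - 1" by simp
    have eq: "(\<Sum>e\<in>inc j i. w e) = 1"
      using that wdeg_S[of w j i] fin(1)
      by (auto simp: T_def wdeg_def inc_def sum.If_cases Int_def)
    then have ne: "inc j i \<noteq> {}" by auto
    have "real (d - 1) = (\<Sum>e\<in>inc j i. real (d - 1) * w e)"
      by (simp add: sum_distrib_left[symmetric] eq)
    also have "\<dots> < (\<Sum>e\<in>inc j i. 1)"
      using ne assms(1) by (intro sum_strict_mono light[folded d_def]) (auto simp: inc_def S_def)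
    finally show False using less by simp
  qed
  have count: "(\<Sum>(j, i)\<in>V. card (inc j i)) = d * card S"
  proof -
    have "(\<Sum>(j, i)\<in>V. card (inc j i)) = (\<Sum>j\<in>J. \<Sum>i\<in>(\<lambda>e. v e j) ` S. card (inc j i))"
      unfolding V_def using assms(2) fin(1) by (subst sum.Sigma) auto
    also have "\<dots> = (\<Sum>j\<in>J. card S)"
    proof (intro sum.cong refl)
      fix j
      have "card S = (\<Sum>i\<in>(\<lambda>e. v e j) ` S. sum (\<lambda>_. 1) {e\<in>S. v e j = i})"
        using sum.group[of S "(\<lambda>e. v e j) ` S" "\<lambda>e. v e j" "\<lambda>_. 1::nat"] fin by simp
      then show "(\<Sum>i\<in>(\<lambda>e. v e j) ` S. card (inc j i)) = card S" by (simp add: inc_def)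
    qed
    finally show ?thesis by (simp add: d_def)
  qed
  \<comment> \<open>The chain from \<open>d * card T\<close> through the incidences at
    \<open>T\<close> and at \<open>V\<close> to \<open>d * card S\<close>, and back by
    \<open>few\<close>, collapses to equalities; hence no vertex of the support lies outside
    \<open>T\<close>.\<close>
  have "d * card T = (\<Sum>(j, i)\<in>T. d)" by (simp add: mult.commute)
  also have "\<dots> \<le> (\<Sum>(j, i)\<in>T. card (inc j i))" by (intro sum_mono) (use tight_deg in auto)
  finally have T_le: "d * card T \<le> (\<Sum>(j, i)\<in>T. card (inc j i))" .
  have split: "(\<Sum>(j, i)\<in>V. card (inc j i)) = (\<Sum>(j, i)\<in>V - T. card (inc j i)) + (\<Sum>(j, i)\<in>T. card (inc j i))"
    by (rule sum.subset_diff[OF TV fin(2)])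
  have "card S \<le> card T" by (rule few) auto
  then have "d * card S \<le> d * card T" by simp
  then have "(\<Sum>(j, i)\<in>V - T. card (inc j i)) = 0" and "d * card T = d * card S"
    using T_le split count by linarith+
  then have zero: "\<And>j i. (j, i) \<in> V - T \<Longrightarrow> card (inc j i) = 0" and "card T = card S"
    using fin(2) assms(3) by (force simp: d_def)+
  have "V = T"
  proof (rule ccontr)
    assume "V \<noteq> T"
    then obtain j i where "(j, i) \<in> V - T" using TV by auto
    then show False using zero[of j i] fin(1) by (auto simp: V_def inc_def)
  qed
  obtain j1 where j1: "j1 \<in> J" using fin by blast
  obtain j2 where j2: "j2 \<in> J" "j2 \<noteq> j1"
    using assms(3) j1 by (metis One_nat_def card_le_Suc0_iff_eq assms(2) not_less_eq_eq numeral_2_eq_2)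
  obtain e0 where e0: "e0 \<in> S" using fin by blast
  have "(j1, v e0 j1) \<in> T" using \<open>V = T\<close> j1 e0 by (auto simp: V_def)
  \<comment> \<open>One tight vertex of part \<open>j1\<close> is redundant: zero degrees throughout
    part \<open>j2\<close> make the total of \<open>z\<close> zero, and in part \<open>j1\<close>
    this total reduces to the degree at the omitted vertex.\<close>
  have "card S \<le> card (T - {(j1, v e0 j1)})"
  proof (rule few)
    fix z j i
    assume z: "\<And>j i. (j, i) \<in> T - {(j1, v e0 j1)} \<Longrightarrow> wdeg S v z j i = 0" and ji: "(j, i) \<in> T"
    have total: "(\<Sum>i\<in>(\<lambda>e. v e j) ` S. wdeg S v z j i) = sum z S" for j
      using fin by (intro sum_wdeg) auto
    have "(\<Sum>i\<in>(\<lambda>e. v e j2) ` S. wdeg S v z j2 i) = 0"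
      using j2 \<open>V = T\<close> by (intro sum.neutral ballI z) (auto simp: V_def)
    then have "(\<Sum>i\<in>(\<lambda>e. v e j1) ` S. wdeg S v z j1 i) = 0" by (simp add: total)
    moreover have "(\<Sum>i\<in>(\<lambda>e. v e j1) ` S. wdeg S v z j1 i)
      = wdeg S v z j1 (v e0 j1) + (\<Sum>i\<in>(\<lambda>e. v e j1) ` S - {v e0 j1}. wdeg S v z j1 i)"
      using fin e0 by (intro sum.remove) auto
    moreover have "(\<Sum>i\<in>(\<lambda>e. v e j1) ` S - {v e0 j1}. wdeg S v z j1 i) = 0"
      using j1 \<open>V = T\<close> by (intro sum.neutral ballI z) (auto simp: V_def)
    ultimately show "wdeg S v z j i = 0" using z ji by (cases "(j, i) = (j1, v e0 j1)") auto
  qed auto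
  then show False
    using \<open>card T = card S\<close> card_Diff1_less[OF fin(3) \<open>(j1, v e0 j1) \<in> T\<close>] by linarith
qed

text \<open>Greedy induction on the number of edges: a heavy edge \<open>e\<close> of a basic
  solution joins the matching, and all edges meeting it are deleted. This costs weight at most
  \<open>card J - 1\<close>.\<close>

theorem multipartite_fractional_matching_bound:
  fixes v :: "'e \<Rightarrow> 'j \<Rightarrow> 'k" and w :: "'e \<Rightarrow> real"
  assumes "finite E" and J: "finite J" "card J \<ge> 2"
    and "\<And>e. e \<in> E \<Longrightarrow> w e \<ge> 0" "\<And>j i. j \<in> J \<Longrightarrow> wdeg E v w j i \<le> 1"
  obtains M where "M \<subseteq> E" "\<And>e f j. \<lbrakk>e \<in> M; f \<in> M; e \<noteq> f; j \<in> J\<rbrakk> \<Longrightarrow> v e j \<noteq> v f j"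
    "sum w E \<le> real (card J - 1) * real (card M)"
proof -
  have "\<exists>M\<subseteq>E. (\<forall>e\<in>M. \<forall>f\<in>M. e \<noteq> f \<longrightarrow> (\<forall>j\<in>J. v e j \<noteq> v f j)) \<and>
      sum w E \<le> real (card J - 1) * real (card M)"
    using assms(1,4,5)
  proof (induction "card E" arbitrary: E w rule: less_induct)
    case less
    have "J \<noteq> {}" using J by auto
    show ?case
    proof (cases "sum w E \<le> 0")
      case True
      then show ?thesis by (intro exI[of _ "{}"]) auto
    next
      case False
      obtain u where u: "\<And>e. e \<in> E \<Longrightarrow> u e \<ge> 0" "\<And>j i. j \<in> J \<Longrightarrow> wdeg E v u j i \<le> 1"
        "sum w E \<le> sum u E"
        and basic: "\<forall>z. (\<forall>e\<in>E. u e = 0 \<longrightarrow> z e = 0) \<and>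
           (\<forall>j\<in>J. \<forall>i. wdeg E v u j i = 1 \<longrightarrow> wdeg E v z j i = 0) \<longrightarrow> (\<forall>e\<in>E. z e = 0)"
        by (rule basic_fractional_matching[OF less.prems(1) J(1) \<open>J \<noteq> {}\<close> less.prems(2,3)]) blast+
      have "\<exists>e\<in>E. u e \<noteq> 0"
      proof (rule ccontr)
        assume "\<not> ?thesis"
        then have "sum u E = 0" by simp
        then show False using False u(3) by simp
      qed
      then obtain e where e: "e \<in> E" "real (card J - 1) * u e \<ge> 1"
        by (rule basic_fractional_matching_heavy_edge[OF less.prems(1) J basic])
      define E' where "E' = {f\<in>E. \<forall>j\<in>J. v f j \<noteq> v e j}"
      have E': "E' \<subseteq> E" "e \<notin> E'" "finite E'"
        using \<open>J \<noteq> {}\<close> less.prems(1) by (auto simp: E'_def)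
      have "card E' < card E" using E' e less.prems(1) by (intro psubset_card_mono) auto
      moreover have "wdeg E' v u j i \<le> 1" if "j \<in> J" for j i
      proof -
        have "wdeg E' v u j i \<le> wdeg E v u j i"
          unfolding wdeg_def using E' u(1) less.prems(1) by (intro sum_mono2) auto
        then show ?thesis using u(2)[OF that, of i] by simp
      qed
      ultimately obtain M where M: "M \<subseteq> E'" "\<forall>e\<in>M. \<forall>f\<in>M. e \<noteq> f \<longrightarrow> (\<forall>j\<in>J. v e j \<noteq> v f j)"
        "sum u E' \<le> real (card J - 1) * real (card M)"
        using less.hyps[of E' u] E' u(1) by (metis subsetD)
      have removed: "sum u (E - E') \<le> real (card J - 1)"
      proof -
        \<comment> \<open>The degrees at the vertices of \<open>e\<close> add up to at most
          \<open>card J\<close>. In that sum each deleted edge counts at least once and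
          \<open>e\<close> counts \<open>card J\<close> times; the surplus from \<open>e\<close> is
          at least 1 because \<open>e\<close> is heavy.\<close>
        have "(\<Sum>f\<in>E - E'. u f) + real (card J - 1) * u e
            = (\<Sum>f\<in>E - E'. u f * (if f = e then real (card J) else 1))"
        proof -
          have "(\<Sum>f\<in>E - E'. u f * (if f = e then real (card J) else 1))
            = (\<Sum>f\<in>E - E'. u f + (if f = e then real (card J - 1) * u e else 0))"
            using J by (intro sum.cong) (auto simp: algebra_simps of_nat_diff)
          then show ?thesis
            using less.prems(1) e E' by (simp add: sum.distrib)
        qed
        also have "\<dots> \<le> (\<Sum>f\<in>E - E'. u f * (\<Sum>j\<in>J. if v f j = v e j then 1 else 0))"
        proof (intro sum_mono mult_left_mono)
          fix f assume f: "f \<in> E - E'"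
          then obtain j where "j \<in> J" "v f j = v e j" by (auto simp: E'_def)
          then have "(1::real) \<le> (\<Sum>j\<in>J. if v f j = v e j then 1 else 0)"
            using member_le_sum[of j J "\<lambda>j. if v f j = v e j then 1 else 0 :: real"] J by auto
          then show "(if f = e then real (card J) else 1) \<le> (\<Sum>j\<in>J. if v f j = v e j then 1 else 0)"
            by auto
        qed (use u in auto)
        also have "\<dots> \<le> (\<Sum>f\<in>E. u f * (\<Sum>j\<in>J. if v f j = v e j then 1 else 0))"
          using u less.prems(1) by (intro sum_mono2) (auto intro!: mult_nonneg_nonneg sum_nonneg)
        also have "\<dots> = (\<Sum>j\<in>J. wdeg E v u j (v e j))"
          unfolding wdeg_def sum_distrib_left
          by (subst sum.swap) (intro sum.cong refl, auto)
        also have "\<dots> \<le> (\<Sum>j\<in>J. 1)" using u by (intro sum_mono) auto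
        finally show ?thesis using e J by (simp add: of_nat_diff)
      qed
      have "sum u E = sum u (E - E') + sum u E'" by (rule sum.subset_diff[OF E'(1) less.prems(1)])
      moreover have "finite M" "e \<notin> M" using M E' finite_subset by blast+
      ultimately have "sum w E \<le> real (card J - 1) * real (card (insert e M))"
        using u(3) removed M(3) by (simp add: algebra_simps)
      moreover have "\<forall>f\<in>M. \<forall>j\<in>J. v f j \<noteq> v e j" using M by (auto simp: E'_def)
      ultimately show ?thesis
        using M e E' by (intro exI[of _ "insert e M"]) (auto 4 3)
    qed
  qed
  then obtain M where "M \<subseteq> E" "\<forall>e\<in>M. \<forall>f\<in>M. e \<noteq> f \<longrightarrow> (\<forall>j\<in>J. v e j \<noteq> v f j)"
    "sum w E \<le> real (card J - 1) * real (card M)"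
    by blast
  then show thesis by (intro that[of M]) auto
qed

subsection \<open>Separated intervals\<close>

text \<open>The passage from topology to combinatorics: a balanced position of the cuts makes the
  pieces of every line the vertices of a multipartite hypergraph in which, after scaling, every
  piece has degree exactly 1.\<close>

lemma uncut_boxes_fractional_matching:
  fixes l r :: "'h \<Rightarrow> 'j::countable \<Rightarrow> real"
  assumes "finite H" "finite J" "J \<noteq> {}"
    and lr: "\<And>h j. \<lbrakk>h \<in> H; j \<in> J\<rbrakk> \<Longrightarrow> A < l h j \<and> l h j \<le> r h j \<and> r h j < B"
    and uncut: "\<And>c :: 'j \<Rightarrow> nat \<Rightarrow> real. \<exists>h\<in>H. \<forall>j\<in>J. \<forall>m\<in>{1..n}. c j m \<notin> {l h j..r h j}"
  obtains E v w c where "E \<subseteq> H" "\<And>h. h \<in> E \<Longrightarrow> w h \<ge> 0" "sum w E = real (Suc n)"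
    "\<And>j i. j \<in> J \<Longrightarrow> wdeg E v w j i \<le> 1" "\<And>j. mono (c j :: nat \<Rightarrow> real)"
    "\<And>h j. \<lbrakk>h \<in> E; j \<in> J\<rbrakk> \<Longrightarrow> {l h j..r h j} \<subseteq> {c j (v h j)<..<c j (Suc (v h j))}"
proof -
  \<comment> \<open>For \<open>x\<close> in the product of simplices, cuts 0 and
    \<open>Suc n\<close> are the ends \<open>A\<close> and \<open>B\<close>, leaving
    \<open>n\<close> genuine cuts. \<psi> measures how deep side \<open>j\<close> of a box lies
    inside piece \<open>i\<close>; \<phi> is the weight of a box, and \<open>F x j i\<close> is the
    share of the total weight lying in piece \<open>i\<close> of line \<open>j\<close>.\<close>
  define cut where "cut x j m = A + (B - A) * (\<Sum>i<m. x (j, i))" for x :: "'j \<times> nat \<Rightarrow> real" and j m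
  define \<psi> where "\<psi> x h j i = max 0 (min (l h j - cut x j i) (cut x j (Suc i) - r h j))" for x h j i
  define \<phi> where "\<phi> x h = (\<Prod>j\<in>J. \<Sum>i\<le>n. \<psi> x h j i)" for x h
  define F where "F x j i = (\<Sum>h\<in>H. \<psi> x h j i * (\<Prod>j'\<in>J - {j}. \<Sum>i'\<le>n. \<psi> x h j' i'))" for x j i
  have "A < B"
  proof -
    obtain h j where "h \<in> H" "j \<in> J" using uncut \<open>J \<noteq> {}\<close> by blast
    then show ?thesis using lr[of h j] by linarith
  qed
  have \<psi>0: "\<psi> x h j i \<ge> 0" for x h j i by (simp add: \<psi>_def)
  have coord: "continuous_on UNIV (\<lambda>x :: 'j \<times> nat \<Rightarrow> real. x p)" for p by simp
  have ccut: "continuous_on UNIV (\<lambda>x. cut x j m)" for j m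
    unfolding cut_def by (intro continuous_intros coord)
  have c\<psi>: "continuous_on UNIV (\<lambda>x. \<psi> x h j i)" for h j i
    unfolding \<psi>_def by (intro continuous_intros ccut)
  obtain x where x0: "\<And>p. x p \<ge> 0" and x1: "\<And>j. j \<in> J \<Longrightarrow> (\<Sum>i\<le>n. x (j, i)) = 1"
    and bal: "\<And>j i. \<lbrakk>j \<in> J; i \<in> {..n}\<rbrakk> \<Longrightarrow> real (card {..n}) * F x j i = (\<Sum>i'\<le>n. F x j i')"
  proof (rule face_preserving_balanced[of J "{..n}" F])
    show "continuous_on UNIV (\<lambda>x. F x j i)" for j i
      unfolding F_def by (intro continuous_intros c\<psi>)
    show "F x j i \<ge> 0" for x j i
      unfolding F_def by (intro sum_nonneg mult_nonneg_nonneg prod_nonneg \<psi>0 ballI)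
    show "F x j i = 0" if "j \<in> J" "x (j, i) = 0" for x j i
    proof -
      \<comment> \<open>A piece of length zero contains no box, which is the face condition.\<close>
      have "\<psi> x h j i = 0" if "h \<in> H" for h
        using lr[OF that \<open>j \<in> J\<close>] \<open>x (j, i) = 0\<close>
        by (auto simp: \<psi>_def cut_def max_def min_def)
      then show ?thesis by (simp add: F_def)
    qed
  qed (use assms(2) in auto)
  define c where "c = cut x"
  define total where "total = sum (\<phi> x) H"
  define E where "E = {h\<in>H. \<phi> x h \<noteq> 0}"
  define v where "v h j = (SOME i. i \<le> n \<and> \<psi> x h j i > 0)" for h j
  have mono_c: "mono (c j)" for j
  proof (rule monoI)
    fix m m' :: nat assume "m \<le> m'"
    then have "(\<Sum>i<m. x (j, i)) \<le> (\<Sum>i<m'. x (j, i))" using x0 by (intro sum_mono2) auto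
    then show "c j m \<le> c j m'" using \<open>A < B\<close> by (simp add: c_def cut_def mult_left_mono)
  qed
  have \<psi>_pos_iff: "\<psi> x h j i > 0 \<longleftrightarrow> c j i < l h j \<and> r h j < c j (Suc i)" for h j i
    by (auto simp: \<psi>_def c_def max_def min_def)
  have unique: "i = i'" if "\<psi> x h j i > 0" "\<psi> x h j i' > 0" "h \<in> H" "j \<in> J" for h j i i'
  proof -
    have False if "\<psi> x h j i > 0" "\<psi> x h j i' > 0" "i < i'" for i i'
      using that monoD[OF mono_c[of j], of "Suc i" i'] lr[OF \<open>h \<in> H\<close> \<open>j \<in> J\<close>]
      by (auto simp: \<psi>_pos_iff)
    then show ?thesis using that by (metis linorder_neqE_nat)
  qed
  have \<phi>0: "\<phi> x h \<ge> 0" for h unfolding \<phi>_def by (intro prod_nonneg sum_nonneg ballI \<psi>0)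
  have v: "v h j \<le> n" "\<psi> x h j (v h j) > 0" if "h \<in> E" "j \<in> J" for h j
  proof -
    have "(\<Sum>i\<le>n. \<psi> x h j i) \<noteq> 0" using that assms(2) by (auto simp: E_def \<phi>_def)
    then obtain i where "i \<le> n" "\<psi> x h j i \<noteq> 0" by (meson sum.not_neutral_contains_not_neutral atMost_iff)
    then have "\<exists>i. i \<le> n \<and> \<psi> x h j i > 0" using \<psi>0[of x h j i] by (auto simp: less_le)
    from someI_ex[OF this] show "v h j \<le> n" "\<psi> x h j (v h j) > 0" by (auto simp: v_def)
  qed
  \<comment> \<open>A box of positive weight lies in just one piece of each line, so the inner sum
    over pieces has a single nonzero term and the product is the full weight of the box.\<close>
  have term_eq: "\<psi> x h j i * (\<Prod>j'\<in>J - {j}. \<Sum>i'\<le>n. \<psi> x h j' i') = (if h \<in> E \<and> v h j = i then \<phi> x h else 0)"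
    if h: "h \<in> H" and j: "j \<in> J" and i: "i \<le> n" for h j i
  proof -
    let ?R = "\<Prod>j'\<in>J - {j}. \<Sum>i'\<le>n. \<psi> x h j' i'"
    have \<phi>: "\<phi> x h = (\<Sum>i\<le>n. \<psi> x h j i) * ?R"
      unfolding \<phi>_def by (rule prod.remove[OF assms(2) j])
    show ?thesis
    proof (cases "h \<in> E")
      case True
      have zero: "\<psi> x h j k = 0" if "k \<noteq> v h j" for k
        using unique[OF _ v(2)[OF True j] h j, of k] that \<psi>0[of x h j k] by (auto simp: less_le)
      have "(\<Sum>i\<le>n. \<psi> x h j i) = (\<Sum>i\<in>{v h j}. \<psi> x h j i)"
        using v(1)[OF True j] zero by (intro sum.mono_neutral_right) auto
      then show ?thesis using \<phi> True zero[of i] by auto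
    next
      case False
      then have "(\<Sum>i\<le>n. \<psi> x h j i) = 0 \<or> ?R = 0" using \<phi> h by (auto simp: E_def)
      then have "\<psi> x h j i * ?R = 0" using i \<psi>0 by (auto simp: sum_nonneg_eq_0_iff)
      then show ?thesis using False by simp
    qed
  qed
  have F_eq: "F x j i = wdeg E v (\<phi> x) j i" if "j \<in> J" "i \<le> n" for j i
  proof -
    have "F x j i = (\<Sum>h\<in>H. if h \<in> E \<and> v h j = i then \<phi> x h else 0)"
      unfolding F_def by (intro sum.cong refl term_eq that)
    also have "\<dots> = wdeg E v (\<phi> x) j i"
      unfolding wdeg_def using assms(1) by (intro sum.mono_neutral_cong_right) (auto simp: E_def)
    finally show ?thesis .
  qed
  have finE: "finite E" using assms(1) by (simp add: E_def)
  have sum_E: "sum (\<phi> x) E = total"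
    unfolding total_def using assms(1) by (intro sum.mono_neutral_left) (auto simp: E_def)
  have sum_F: "(\<Sum>i\<le>n. F x j i) = total" if "j \<in> J" for j
  proof -
    have "(\<Sum>i\<le>n. F x j i) = (\<Sum>i\<le>n. wdeg E v (\<phi> x) j i)" using F_eq that by simp
    also have "\<dots> = total" using sum_wdeg[OF finE, of "{..n}" v j "\<phi> x"] v that sum_E by auto
    finally show ?thesis .
  qed
  have "total > 0"
  proof -
    obtain h where h: "h \<in> H" and miss: "\<forall>j\<in>J. \<forall>m\<in>{1..n}. c j m \<notin> {l h j..r h j}"
      using uncut[of c] by blast
    have "(\<Sum>i\<le>n. \<psi> x h j i) > 0" if j: "j \<in> J" for j
    proof -
      have c0: "c j 0 < l h j" and cn: "r h j < c j (Suc n)"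
        using lr[OF h j] x1[OF j] by (auto simp: c_def cut_def lessThan_Suc_atMost)
      \<comment> \<open>The last cut left of the box. The next one is either the end
        \<open>B\<close> or a genuine cut that is not left of the box and misses it, so the box fits
        into piece \<open>i\<close>.\<close>
      define i where "i = Max {m\<in>{..n}. c j m < l h j}"
      have "i \<in> {m\<in>{..n}. c j m < l h j}" unfolding i_def using c0 by (intro Max_in) auto
      then have i: "i \<le> n" "c j i < l h j" by auto
      have "r h j < c j (Suc i)"
      proof (cases "i = n")
        case True
        then show ?thesis using cn by simp
      next
        case False
        have "\<not> c j (Suc i) < l h j"
        proof
          assume "c j (Suc i) < l h j"
          then have "Suc i \<le> i" unfolding i_def using False i by (intro Max_ge) (auto simp: i_def)
          then show False by simp
        qed
        then show ?thesis using miss j False i by (force dest!: bspec[of _ _ "Suc i"])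
      qed
      then have "\<psi> x h j i > 0" using i by (simp add: \<psi>_pos_iff)
      then show ?thesis using i \<psi>0 by (intro sum_pos2[of _ i]) auto
    qed
    then have "\<phi> x h > 0" unfolding \<phi>_def by (intro prod_pos) auto
    then show ?thesis unfolding total_def using h \<phi>0 assms(1) by (intro sum_pos2[of _ h]) auto
  qed
  \<comment> \<open>By balance each of the \<open>Suc n\<close> pieces carries
    \<open>total / Suc n\<close>, so this factor makes every degree 1.\<close>
  define w where "w h = real (Suc n) / total * \<phi> x h" for h
  show thesis
  proof (rule that[of E w v c])
    show "w h \<ge> 0" for h using \<phi>0[of h] \<open>total > 0\<close> by (simp add: w_def)
    show "sum w E = real (Suc n)"
      unfolding w_def sum_distrib_left[symmetric] sum_E using \<open>total > 0\<close> by simp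
    show "wdeg E v w j i \<le> 1" if j: "j \<in> J" for j i
    proof -
      have w_eq: "wdeg E v w j i = real (Suc n) / total * wdeg E v (\<phi> x) j i"
        unfolding w_def by (rule wdeg_scaled)
      show ?thesis
      proof (cases "i \<le> n")
        case True
        then have "real (Suc n) * F x j i = total" using bal[of j i] sum_F[OF j] j by simp
        then show ?thesis using w_eq F_eq[OF j True] \<open>total > 0\<close> by (simp add: field_simps)
      next
        case False
        then have "wdeg E v (\<phi> x) j i = 0"
          using v(1) j by (auto simp: wdeg_def intro!: sum.neutral)
        then show ?thesis using w_eq by simp
      qed
    qed
    show "{l h j..r h j} \<subseteq> {c j (v h j)<..<c j (Suc (v h j))}" if "h \<in> E" "j \<in> J" for h j
      using v(2)[OF that] by (auto simp: \<psi>_pos_iff)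
  qed (use mono_c in \<open>auto simp: E_def\<close>)
qed

text \<open>An edge that misses a line is given a one-point interval on it, disjoint from all others.\<close>

lemma sep_d_hypergraph_enclosing_boxes:
  assumes "sep_d_hypergraph d H"
  obtains l r :: "point set \<Rightarrow> nat \<Rightarrow> real" and A B where
    "\<And>h j. \<lbrakk>h \<in> H; j \<in> {1..d}\<rbrakk> \<Longrightarrow> A < l h j \<and> l h j \<le> r h j \<and> r h j < B"
    "\<And>h j x. \<lbrakk>h \<in> H; j \<in> {1..d}; (j, x) \<in> h\<rbrakk> \<Longrightarrow> x \<in> {l h j..r h j}"
    "\<And>h j x. \<lbrakk>h \<in> H; j \<in> {1..d}; x \<in> {l h j..r h j}; (j, x) \<notin> h\<rbrakk> \<Longrightarrow>
       \<forall>h'\<in>H. x \<in> {l h' j..r h' j} \<longrightarrow> h' = h"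
proof -
  have finH: "finite H" and sep: "\<And>h. h \<in> H \<Longrightarrow> sep_d_interval d h"
    using assms by (auto simp: sep_d_hypergraph_def)
  define P where "P h j \<longleftrightarrow> {x. (j, x) \<in> h} \<noteq> {}" for h :: "point set" and j
  have "\<forall>h j. \<exists>a b. h \<in> H \<and> j \<in> {1..d} \<and> P h j \<longrightarrow> a \<le> b \<and> {x. (j, x) \<in> h} = {a..b}"
    using sep unfolding sep_d_interval_def P_def by metis
  then obtain a b where ab: "\<And>h j. \<lbrakk>h \<in> H; j \<in> {1..d}; P h j\<rbrakk> \<Longrightarrow> a h j \<le> b h j"
    "\<And>h j. \<lbrakk>h \<in> H; j \<in> {1..d}; P h j\<rbrakk> \<Longrightarrow> {x. (j, x) \<in> h} = {a h j..b h j}"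
    by metis
  have bounded: "\<exists>D. \<forall>h\<in>H. \<forall>j\<in>{1..d}. \<bar>f h j\<bar> < D" for f :: "point set \<Rightarrow> nat \<Rightarrow> real"
  proof -
    have "finite ((\<lambda>(h, j). \<bar>f h j\<bar>) ` (H \<times> {1..d}))" using finH by simp
    then obtain D where "\<forall>y\<in>(\<lambda>(h, j). \<bar>f h j\<bar>) ` (H \<times> {1..d}). y \<le> D"
      using bdd_above_finite unfolding bdd_above_def by blast
    then have "\<bar>f h j\<bar> \<le> D" if "h \<in> H" "j \<in> {1..d}" for h j using that by auto
    then show ?thesis by (intro exI[of _ "D + 1"]) fastforce
  qed
  obtain D where D: "\<forall>h\<in>H. \<forall>j\<in>{1..d}. \<bar>b h j\<bar> < D" using bounded by blast
  obtain idx :: "point set \<Rightarrow> nat" where idx: "inj_on idx H"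
    using finite_imp_inj_to_nat_seg[OF finH] by blast
  \<comment> \<open>The dummy points lie beyond all genuine right ends, which are below
    \<open>D\<close>, and are pairwise distinct because \<open>idx\<close> is injective.\<close>
  define l where "l h j = (if P h j then a h j else D + real (idx h))" for h j
  define r where "r h j = (if P h j then b h j else D + real (idx h))" for h j
  obtain A where A: "\<forall>h\<in>H. \<forall>j\<in>{1..d}. \<bar>l h j\<bar> < A" using bounded by blast
  obtain B where B: "\<forall>h\<in>H. \<forall>j\<in>{1..d}. \<bar>r h j\<bar> < B" using bounded by blast
  show thesis
  proof (rule that[of "- A" l r B])
    show "- A < l h j \<and> l h j \<le> r h j \<and> r h j < B" if "h \<in> H" "j \<in> {1..d}" for h j
    proof -
      have "\<bar>l h j\<bar> < A" "\<bar>r h j\<bar> < B" using A B that by blast+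
      moreover have "l h j \<le> r h j" using ab(1)[OF that] by (simp add: l_def r_def)
      ultimately show ?thesis by linarith
    qed
    show "x \<in> {l h j..r h j}" if "h \<in> H" "j \<in> {1..d}" "(j, x) \<in> h" for h j x
    proof -
      have "P h j" using that by (auto simp: P_def)
      then show ?thesis using ab(2)[OF that(1,2)] that(3) by (auto simp: l_def r_def)
    qed
    show "\<forall>h'\<in>H. x \<in> {l h' j..r h' j} \<longrightarrow> h' = h"
      if h: "h \<in> H" and j: "j \<in> {1..d}" and x: "x \<in> {l h j..r h j}" "(j, x) \<notin> h" for h j x
    proof (intro ballI impI)
      fix h' assume h': "h' \<in> H" "x \<in> {l h' j..r h' j}"
      have "\<not> P h j"
      proof
        assume "P h j"
        then have "x \<in> {x. (j, x) \<in> h}" using ab(2)[OF h j] x(1) by (simp add: l_def r_def)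
        then show False using x(2) by simp
      qed
      then have x_eq: "x = D + real (idx h)" using x by (simp add: l_def r_def)
      show "h' = h"
      proof (cases "P h' j")
        case True
        then have "x \<le> b h' j" using h' by (simp add: r_def)
        moreover have "\<bar>b h' j\<bar> < D" using D h' j by blast
        ultimately show ?thesis using x_eq by linarith
      next
        case False
        then have "idx h' = idx h" using h' x_eq by (simp add: l_def r_def)
        then show ?thesis using idx h h' by (auto dest: inj_onD)
      qed
    qed
  qed
qed

section \<open>Matching and cover numbers, and the final contradiction\<close>

lemma card_matching_le_matching_number:
  assumes "finite H" "is_matching H M"
  shows "card M \<le> matching_number H"
proof -
  have "finite {card M |M. is_matching H M}"
    by (rule finite_subset[of _ "card ` Pow H"]) (use assms in \<open>auto simp: is_matching_def\<close>)
  then show ?thesis unfolding matching_number_def using assms by (intro Max_ge) auto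
qed

lemma cover_number_le_card: "is_cover H C \<Longrightarrow> cover_number H \<le> card C"
  unfolding cover_number_def by (rule cInf_lower) auto

theorem theorem6p3:
  fixes d :: nat and H :: "point set set"
  assumes "d \<ge> 2"
    and "sep_d_hypergraph d H"
    and "\<forall>h\<in>H. h \<noteq> {}"
  shows "cover_number H \<le> (d^2 - d) * matching_number H"
proof (rule ccontr)
  assume large: "\<not> ?thesis"
  define n where "n = (d - 1) * matching_number H"
  have finH: "finite H" and sub: "\<And>h. h \<in> H \<Longrightarrow> h \<subseteq> {1..d} \<times> UNIV"
    using assms(2) by (auto simp: sep_d_hypergraph_def sep_d_interval_def)
  obtain l r A B where
    lr: "\<And>h j. \<lbrakk>h \<in> H; j \<in> {1..d}\<rbrakk> \<Longrightarrow> A < l h j \<and> l h j \<le> r h j \<and> r h j < B"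
    and box: "\<And>h j x. \<lbrakk>h \<in> H; j \<in> {1..d}; (j, x) \<in> h\<rbrakk> \<Longrightarrow> x \<in> {l h j..r h j}"
    and dummy: "\<And>h j x. \<lbrakk>h \<in> H; j \<in> {1..d}; x \<in> {l h j..r h j}; (j, x) \<notin> h\<rbrakk> \<Longrightarrow>
       \<forall>h'\<in>H. x \<in> {l h' j..r h' j} \<longrightarrow> h' = h"
    by (rule sep_d_hypergraph_enclosing_boxes[OF assms(2)]) (rule that, blast+)
  \<comment> \<open>There are \<open>d * n\<close>, that is
    \<open>(d^2 - d) * matching_number H\<close>, cuts; if they hit every box, they could be turned
    into a cover that is too small.\<close>
  have uncut: "\<exists>h\<in>H. \<forall>j\<in>{1..d}. \<forall>m\<in>{1..n}. c j m \<notin> {l h j..r h j}" for c :: "nat \<Rightarrow> nat \<Rightarrow> real"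
  proof (rule ccontr)
    assume "\<not> ?thesis"
    then have hit: "\<exists>j\<in>{1..d}. \<exists>m\<in>{1..n}. c j m \<in> {l h j..r h j}" if "h \<in> H" for h using that by blast
    \<comment> \<open>A cut in no edge may still hit a dummy interval. It is then replaced by a
      point of the edge owning that dummy, which exists because edges are nonempty.\<close>
    define g where "g p = (if \<exists>h\<in>H. p \<in> h then p
      else SOME q. \<exists>h\<in>H. snd p \<in> {l h (fst p)..r h (fst p)} \<and> q \<in> h)" for p
    define C where "C = (\<lambda>(j, m). g (j, c j m)) ` ({1..d} \<times> {1..n})"
    have "is_cover H C"
      unfolding is_cover_def
    proof (intro conjI ballI)
      show "finite C" by (simp add: C_def)
      fix h assume h: "h \<in> H"
      obtain j m where jm: "j \<in> {1..d}" "m \<in> {1..n}" "c j m \<in> {l h j..r h j}" using hit[OF h] by blast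
      have "g (j, c j m) \<in> h"
      proof (cases "(j, c j m) \<in> h")
        case True
        then show ?thesis using h by (auto simp: g_def)
      next
        case False
        note only = dummy[OF h jm(1,3) False]
        \<comment> \<open>An edge through this point would have it in its box and so would equal
          \<open>h\<close> by \<open>only\<close>. Hence the choice in \<open>g\<close> can only
          return a point of \<open>h\<close>.\<close>
        have none: "\<not> (\<exists>h\<in>H. (j, c j m) \<in> h)"
          using only box[OF _ jm(1)] False by blast
        obtain q where "q \<in> h" using assms(3) h by blast
        then have "\<exists>q. \<exists>h\<in>H. c j m \<in> {l h j..r h j} \<and> q \<in> h" using h jm by blast
        from someI_ex[OF this] none only show ?thesis by (auto simp: g_def)
      qed
      then show "C \<inter> h \<noteq> {}" using jm by (force simp: C_def)
    qed
    then have "cover_number H \<le> card C" by (rule cover_number_le_card)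
    also have "\<dots> \<le> card ({1..d} \<times> {1..n})" unfolding C_def by (rule card_image_le) simp
    also have "\<dots> = (d^2 - d) * matching_number H"
      by (simp add: n_def power2_eq_square diff_mult_distrib2 mult.assoc[symmetric])
    finally show False using large by simp
  qed
  obtain E v w c where E: "E \<subseteq> H" and w: "\<And>h. h \<in> E \<Longrightarrow> w h \<ge> 0" "sum w E = real (Suc n)"
    "\<And>j i. j \<in> {1..d} \<Longrightarrow> wdeg E v w j i \<le> 1" and mono_c: "\<And>j. mono (c j :: nat \<Rightarrow> real)"
    and vc: "\<And>h j. \<lbrakk>h \<in> E; j \<in> {1..d}\<rbrakk> \<Longrightarrow> {l h j..r h j} \<subseteq> {c j (v h j)<..<c j (Suc (v h j))}"
    by (rule uncut_boxes_fractional_matching[of H "{1..d}" A l r B n])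
       (use finH assms(1) lr uncut in auto)
  obtain M where M: "M \<subseteq> E"
    "\<And>e f j. \<lbrakk>e \<in> M; f \<in> M; e \<noteq> f; j \<in> {1..d}\<rbrakk> \<Longrightarrow> v e j \<noteq> v f j"
    "sum w E \<le> real (card {1..d} - 1) * real (card M)"
    by (rule multipartite_fractional_matching_bound[of E "{1..d}" w v])
       (use finH finite_subset[OF E] assms(1) w in auto)
  have "is_matching H M"
    unfolding is_matching_def pairwise_def disjnt_def
  proof (intro conjI ballI impI)
    show "M \<subseteq> H" using M E by blast
    \<comment> \<open>Distinct pieces of a line are disjoint open intervals in increasing order, so
      edges in different pieces share no point there.\<close>
    have disj: False if "e \<in> M" "f \<in> M" "j \<in> {1..d}" "(j, y) \<in> e" "(j, y) \<in> f" "v e j < v f j" for e f j y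
    proof -
      have "y < c j (Suc (v e j))" "c j (v f j) < y"
        using that box[of _ j y] vc[of _ j] M(1) E by (force simp: subset_iff)+
      then show False using monoD[OF mono_c[of j], of "Suc (v e j)" "v f j"] that by simp
    qed
    fix e f assume ef: "e \<in> M" "f \<in> M" "e \<noteq> f"
    show "e \<inter> f = {}"
    proof (rule ccontr)
      assume "e \<inter> f \<noteq> {}"
      then obtain j y where jy: "(j, y) \<in> e" "(j, y) \<in> f" by auto
      then have "j \<in> {1..d}" using sub[of e] ef(1) M(1) E by blast
      then show False
        using disj[of e f j y] disj[of f e j y] M(2)[OF ef] jy ef by (metis linorder_neqE_nat)
    qed
  qed
  then have "card M \<le> matching_number H" using finH by (rule card_matching_le_matching_number[rotated])
  \<comment> \<open>The extra unit matters: the fractional matching has size \<open>Suc n\<close>,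
    while \<open>n\<close> is all that the matching number allows.\<close>
  then have "(d - 1) * card M \<le> n" by (simp add: n_def)
  moreover have "real (Suc n) \<le> real ((d - 1) * card M)"
    using M(3) w(2) by (metis card_atLeastAtMost diff_Suc_1 of_nat_mult)
  ultimately show False by linarith
qed

end
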